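(* For every graph $F$ and every edge $e\in E(F)$ we have $$M_F(n)\leq\bigg(\frac{\chi(F-e)-2}{\chi(F-e)-1}+o(1)\bigg)\binom{n}{2},$$ that is, for every $\varepsilon>0$ there is $n_0$ such that $M_F(n)\leq\big(\frac{\chi(F-e)-2}{\chi(F-e)-1}+\varepsilon\big)\binom{n}{2}$ for all integers $n\geq n_0$.
   Context: For a graph $F$, $\chi(F)$ is its chromatic number and $F-e$ denotes the graph $(V(F),E(F)\setminus\{e\})$. For graphs $F$ and $H$, a copy of $F$ in $H$ is a subgraph of $H$ isomorphic to $F$, and $c(F,H)$ is the number of copies of $F$ in $H$. For a pair $e$ of vertices of $H$, $H\cup e$ denotes $(V(H),E(H)\cup\{e\})$. The $F$-bootstrap percolation process ($F$-process) starting with $H$ is the sequence $(H_i)_{i\geq 0}$ with $H_0=H$ and $H_{i+1}$ the graph on $V(H)$ with edge set $E(H_i)\cup\{e\in V(H)^{(2)}: c(F,H_i\cup e)>c(F,H_i)\}$, where $V(H)^{(2)}$ is the set of $2$-element subsets of $V(H)$. The running time is $\tau_F(H)=\min\{t\in\mathbb{N}_{\geq 0}: H_t=H_{t+1}\}$, and $M_F(n)=\max\{\tau_F(H): H \text{ a graph on } n \text{ vertices}\}$. *)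

theory Defs
  imports Complex_Main "HOL-Library.Ramsey"
begin

text \<open>From \<^theory>\<open>HOL-Library.Ramsey\<close> we take only \<^const>\<open>nsets\<close>: \<open>[V]\<^bsup>2\<^esup>\<close> is the set of
  2-element subsets of \<open>V\<close>.\<close>

record 'a ugraph =
  verts :: "'a set"
  edges :: "'a set set"

text \<open>Graphs are finite and simple.\<close>

definition is_graph :: "'a ugraph \<Rightarrow> bool" where
  "is_graph G \<longleftrightarrow> finite (verts G) \<and> edges G \<subseteq> [verts G]\<^bsup>2\<^esup>"

definition add_edge :: "'a ugraph \<Rightarrow> 'a set \<Rightarrow> 'a ugraph" where
  "add_edge G e = G\<lparr>edges := edges G \<union> {e}\<rparr>"

definition del_edge :: "'a ugraph \<Rightarrow> 'a set \<Rightarrow> 'a ugraph" where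
  "del_edge G e = G\<lparr>edges := edges G - {e}\<rparr>"

definition proper_colouring :: "'a ugraph \<Rightarrow> nat \<Rightarrow> ('a \<Rightarrow> nat) \<Rightarrow> bool" where
  "proper_colouring G k f \<longleftrightarrow>
     f ` verts G \<subseteq> {..<k} \<and> (\<forall>u v. {u, v} \<in> edges G \<longrightarrow> f u \<noteq> f v)"

definition chromatic_number :: "'a ugraph \<Rightarrow> nat" where
  "chromatic_number G = (LEAST k. \<exists>f. proper_colouring G k f)"

definition subgraph :: "'a ugraph \<Rightarrow> 'a ugraph \<Rightarrow> bool" where
  "subgraph G H \<longleftrightarrow> is_graph G \<and> verts G \<subseteq> verts H \<and> edges G \<subseteq> edges H"

definition isomorphic :: "'a ugraph \<Rightarrow> 'b ugraph \<Rightarrow> bool" where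
  "isomorphic G H \<longleftrightarrow>
     (\<exists>f. bij_betw f (verts G) (verts H) \<and> edges H = (\<lambda>e. f ` e) ` edges G)"

definition copies :: "'a ugraph \<Rightarrow> 'b ugraph \<Rightarrow> 'b ugraph set" where
  "copies F H = {C. subgraph C H \<and> isomorphic F C}"

definition num_copies :: "'a ugraph \<Rightarrow> 'b ugraph \<Rightarrow> nat" where
  "num_copies F H = card (copies F H)"

definition process_step :: "'a ugraph \<Rightarrow> 'b ugraph \<Rightarrow> 'b ugraph" where
  "process_step F H = H\<lparr>edges := edges H \<union>
     {e \<in> [verts H]\<^bsup>2\<^esup>. num_copies F (add_edge H e) > num_copies F H}\<rparr>"

primrec process :: "'a ugraph \<Rightarrow> 'b ugraph \<Rightarrow> nat \<Rightarrow> 'b ugraph" where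
  "process F H 0 = H"
| "process F H (Suc i) = process_step F (process F H i)"

definition running_time :: "'a ugraph \<Rightarrow> 'b ugraph \<Rightarrow> nat" where
  "running_time F H = (LEAST t. process F H t = process F H (Suc t))"

text \<open>Every finite graph is isomorphic to one whose vertices are natural numbers, so it suffices to
  let \<open>H\<close> range over these. There are infinitely many such \<open>H\<close> for \<open>n > 0\<close>, but the set of running
  times is finite (each is at most \<open>n choose 2\<close>), so \<^const>\<open>Max\<close> is meaningful.\<close>

definition max_running_time :: "'a ugraph \<Rightarrow> nat \<Rightarrow> nat" where
  "max_running_time F n =
     Max {running_time F H | H :: nat ugraph. is_graph H \<and> card (verts H) = n}"

end

(* Choose one new edge per step. If the process ran longer than claimed, the chosen edges would by
   Erdos--Stone contain a large complete r-partite graph with r = max 2 (chi (F - e)). Let xy be its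
   edge added last, in step j. Discarding the other endpoints of the edges chosen one and two steps
   before j leaves a complete r-partite graph whose edges other than xy are all present at time
   j - 2. If some r-colouring of F - e separates the ends of e, xy is then the missing edge of a
   copy of F. Otherwise each pair inside a part is a missing edge, so that one step later only xy
   can be missing from a large clique. In both cases xy is present by time j, contradicting its choice.

   Erdos--Stone follows from its minimum-degree version, applied to a vertex set W maximising
   e(W) - alpha * (|W| + 1 choose 2). *)
theory Submission
  imports Defs "HOL-Combinatorics.Transposition"
begin

subsection \<open>The Erdos--Stone theorem\<close>

text \<open>Pairs inside a part are unconstrained, so the subgraph need not be induced. Disjointness
  of the parts is implicit when \<open>E\<close> consists of 2-element sets: a vertex
  \<open>x\<close> in two parts would put \<open>{x, x}\<close> into \<open>E\<close>.\<close>

definition multipartite :: "'a set \<Rightarrow> 'a set set \<Rightarrow> nat \<Rightarrow> nat \<Rightarrow> (nat \<Rightarrow> 'a set) \<Rightarrow> bool" where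
  "multipartite V E r t A \<longleftrightarrow>
     (\<forall>i<r. A i \<subseteq> V \<and> card (A i) = t) \<and>
     (\<forall>i<r. \<forall>j<r. i \<noteq> j \<longrightarrow> (\<forall>x\<in>A i. \<forall>y\<in>A j. {x, y} \<in> E))"

lemma doubleton_mem_nsets_2:
  "{x, y} \<in> [V]\<^bsup>2\<^esup> \<longleftrightarrow> x \<in> V \<and> y \<in> V \<and> x \<noteq> y"
  by (auto simp: nsets_def card_insert_if)

section \<open>Adding a part to a complete multipartite subgraph\<close>

lemma large_fibre:
  assumes "finite W" "finite Y" "f ` W \<subseteq> Y" "card Y * t < card W"
  obtains y where "y \<in> Y" "t \<le> card {w \<in> W. f w = y}"
proof -
  have "\<exists>y\<in>Y. t \<le> card {w \<in> W. f w = y}"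
  proof (rule ccontr)
    assume *: "\<not> ?thesis"
    have "card W = card (\<Union>y\<in>Y. {w \<in> W. f w = y})"
      using assms(3) by (intro arg_cong[where f = card]) auto
    also have "\<dots> \<le> (\<Sum>y\<in>Y. card {w \<in> W. f w = y})"
      by (rule card_UN_le) fact
    also have "\<dots> \<le> (\<Sum>y\<in>Y. t)"
      using * by (intro sum_mono) auto
    finally show False using assms(4) by simp
  qed
  with that show ?thesis by blast
qed

text \<open>Each \<open>w\<close> in \<open>W\<close> chooses \<open>t\<close> neighbours in every
  part. There are at most \<open>(T choose t) ^ r\<close> joint choices, so by pigeonhole some
  \<open>t\<close> vertices share one. They form the new part, and the shared choice cuts the old
  parts from size \<open>T\<close> to \<open>t\<close>.\<close>

lemma multipartite_extend:
  fixes V :: "'a set"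
  assumes "finite V" and A: "multipartite V E r T A"
    and W: "W \<subseteq> {w \<in> V. \<forall>i<r. t \<le> card {x \<in> A i. {w, x} \<in> E}}"
    and large: "(T choose t) ^ r * t < card W"
  obtains B where "multipartite V E (Suc r) t B"
proof -
  have finA: "finite (A i)" "card (A i) = T" "A i \<subseteq> V" if "i < r" for i
    using A that \<open>finite V\<close> by (auto simp: multipartite_def intro: finite_subset)
  have "\<exists>S. S \<in> PiE {..<r} (\<lambda>i. [A i]\<^bsup>t\<^esup>) \<and> (\<forall>i<r. \<forall>x\<in>S i. {w, x} \<in> E)" if "w \<in> W" for w
  proof -
    have "\<exists>S. S \<subseteq> {x \<in> A i. {w, x} \<in> E} \<and> card S = t \<and> finite S" if "i \<in> {..<r}" for i
    proof -
      have "t \<le> card {x \<in> A i. {w, x} \<in> E}" using W \<open>w \<in> W\<close> that by auto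
      then show ?thesis by (meson obtain_subset_with_card_n)
    qed
    then have "\<exists>S. \<forall>i\<in>{..<r}. S i \<subseteq> {x \<in> A i. {w, x} \<in> E} \<and> card (S i) = t \<and> finite (S i)"
      by (intro bchoice) blast
    then obtain S where S: "\<And>i. i < r \<Longrightarrow> S i \<subseteq> {x \<in> A i. {w, x} \<in> E} \<and> card (S i) = t \<and> finite (S i)"
      by auto
    have "restrict S {..<r} \<in> PiE {..<r} (\<lambda>i. [A i]\<^bsup>t\<^esup>)"
      by (rule restrict_PiE_iff[THEN iffD2]) (use S in \<open>auto simp: nsets_def\<close>)
    moreover have "\<forall>i<r. \<forall>x\<in>restrict S {..<r} i. {w, x} \<in> E" using S by fastforce
    ultimately show ?thesis by blast
  qed
  then have "\<forall>w\<in>W. \<exists>S. S \<in> PiE {..<r} (\<lambda>i. [A i]\<^bsup>t\<^esup>) \<and> (\<forall>i<r. \<forall>x\<in>S i. {w, x} \<in> E)" by blast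
  from bchoice[OF this] obtain S where
    S: "\<And>w. w \<in> W \<Longrightarrow> S w \<in> PiE {..<r} (\<lambda>i. [A i]\<^bsup>t\<^esup>)"
      "\<And>w i x. w \<in> W \<Longrightarrow> i < r \<Longrightarrow> x \<in> S w i \<Longrightarrow> {w, x} \<in> E"
    by blast
  let ?Y = "PiE {..<r} (\<lambda>i. [A i]\<^bsup>t\<^esup>)"
  have finY: "finite ?Y" using finA by (intro finite_PiE) (auto intro: finite_imp_finite_nsets)
  have "card ?Y = (T choose t) ^ r" using finA by (simp add: card_PiE card_nsets)
  then have small: "card ?Y * t < card W" using large by simp
  have "finite W" using W \<open>finite V\<close> by (auto intro: finite_subset)
  then obtain g where g: "g \<in> ?Y" "t \<le> card {w \<in> W. S w = g}"
    using large_fibre[OF _ finY _ small, of S] S(1) by blast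
  obtain C where C: "C \<subseteq> {w \<in> W. S w = g}" "card C = t"
    using g(2) by (meson obtain_subset_with_card_n)
  have gA: "g i \<subseteq> A i" "card (g i) = t" if "i < r" for i
    using g(1) that by (auto simp: nsets_def PiE_iff Ball_def)
  have CE: "{w, x} \<in> E" if "w \<in> C" "i < r" "x \<in> g i" for w i x
    using S(2) C that by blast
  have "multipartite V E (Suc r) t (g(r := C))"
    unfolding multipartite_def
  proof (intro conjI allI impI ballI)
    fix i assume "i < Suc r"
    then consider "i = r" | "i \<noteq> r" "i < r" by linarith
    then show "(g(r := C)) i \<subseteq> V"
    proof cases
      case 1 then show ?thesis using C W by auto
    next
      case 2 then show ?thesis using gA(1)[of i] finA(3)[of i] by simp
    qed
    show "card ((g(r := C)) i) = t" using \<open>i < Suc r\<close> gA C by (cases "i = r") auto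
  next
    fix i j x y
    assume *: "i < Suc r" "j < Suc r" "i \<noteq> j" "x \<in> (g(r := C)) i" "y \<in> (g(r := C)) j"
    consider "i = r" "j < r" | "i < r" "j = r" | "i < r" "j < r" using * by linarith
    then show "{x, y} \<in> E"
    proof cases
      case 1 then show ?thesis using CE[of x j y] * by simp
    next
      case 2 then show ?thesis using CE[of y i x] * by (simp add: insert_commute)
    next
      case 3
      then have "x \<in> A i" "y \<in> A j" using gA * by auto
      then show ?thesis using A 3 * unfolding multipartite_def by blast
    qed
  qed
  then show ?thesis by (rule that)
qed

lemma sum_card_nonadjacent_swap:
  assumes "finite V" "finite B"
  shows "(\<Sum>u\<in>V. card {v \<in> B. {u, v} \<notin> E}) = (\<Sum>v\<in>B. card {u \<in> V. {v, u} \<notin> E})"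
proof -
  have "(\<Sum>u\<in>V. card {v \<in> B. {u, v} \<notin> E}) = (\<Sum>u\<in>V. \<Sum>v\<in>B. if {u, v} \<notin> E then 1 else 0)"
    using assms by (simp add: sum.If_cases Int_def)
  also have "\<dots> = (\<Sum>v\<in>B. \<Sum>u\<in>V. if {v, u} \<notin> E then 1 else 0)"
    by (subst sum.swap) (simp add: insert_commute)
  also have "\<dots> = (\<Sum>v\<in>B. card {u \<in> V. {v, u} \<notin> E})"
    using assms by (simp add: sum.If_cases Int_def)
  finally show ?thesis .
qed

text \<open>Double counting of non-adjacent pairs between \<open>V\<close> and the union
  \<open>B\<close> of the parts. A vertex outside the set in question misses more than
  \<open>T - t\<close> vertices of some part, whereas each of the at most \<open>r * T\<close>
  vertices of \<open>B\<close> has at most \<open>(1 - \<epsilon>) * card V / r\<close>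
  non-neighbours.\<close>

lemma many_well_connected:
  fixes V :: "'a set" and \<epsilon> :: real and t :: nat
  assumes "finite V" "0 < \<epsilon>" "0 < r" and A: "multipartite V E r T A" and T: "2 * t \<le> \<epsilon> * T" "0 < T"
    and codeg: "\<And>v. v \<in> V \<Longrightarrow> real r * card {u\<in>V. {v, u} \<notin> E} \<le> (1 - \<epsilon>) * card V"
  shows "\<epsilon> / 2 * card V \<le> card {w \<in> V. \<forall>i<r. t \<le> card {x \<in> A i. {w, x} \<in> E}}" (is "_ \<le> real (card ?W)")
proof -
  have finA: "finite (A i)" "card (A i) = T" "A i \<subseteq> V" if "i < r" for i
    using A that \<open>finite V\<close> by (auto simp: multipartite_def intro: finite_subset)
  define B where "B = (\<Union>i<r. A i)"
  have B: "finite B" "B \<subseteq> V" using finA by (auto simp: B_def)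
  have cardB: "card B \<le> r * T"
    using card_UN_le[of "{..<r}" A] finA(2) by (simp add: B_def)
  let ?W' = "V - ?W"
  have le: "real T - real t \<le> card {v \<in> B. {u, v} \<notin> E}" if u: "u \<in> ?W'" for u
  proof -
    obtain i where i: "i < r" "card {x \<in> A i. {u, x} \<in> E} < t" using u by auto
    have "T = card ({x \<in> A i. {u, x} \<in> E} \<union> {x \<in> A i. {u, x} \<notin> E})"
      using finA(2)[OF i(1)] by (simp flip: Collect_disj_eq conj_disj_distribL)
    also have "\<dots> \<le> card {x \<in> A i. {u, x} \<in> E} + card {x \<in> A i. {u, x} \<notin> E}"
      by (rule card_Un_le)
    also have "card {x \<in> A i. {u, x} \<notin> E} \<le> card {v \<in> B. {u, v} \<notin> E}"
      using B i by (intro card_mono) (auto simp: B_def)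
    finally show ?thesis using i(2) by linarith
  qed
  have "real r * (card ?W' * (real T - t)) = real r * (\<Sum>u\<in>?W'. real T - t)" by simp
  also have "\<dots> \<le> real r * (\<Sum>u\<in>?W'. real (card {v \<in> B. {u, v} \<notin> E}))"
    by (intro mult_left_mono sum_mono le) auto
  also have "\<dots> \<le> real r * (\<Sum>u\<in>V. real (card {v \<in> B. {u, v} \<notin> E}))"
    by (intro mult_left_mono sum_mono2) (use \<open>finite V\<close> in auto)
  also have "\<dots> = (\<Sum>v\<in>B. real r * real (card {u \<in> V. {v, u} \<notin> E}))"
    using sum_card_nonadjacent_swap[OF \<open>finite V\<close> B(1), of E]
    by (simp flip: of_nat_sum sum_distrib_left)
  also have "\<dots> \<le> (\<Sum>v\<in>B. (1 - \<epsilon>) * card V)"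
    using codeg B by (intro sum_mono) auto
  also have "\<dots> = card B * ((1 - \<epsilon>) * card V)" by simp
  also have "\<dots> \<le> real (r * T) * ((1 - \<epsilon>) * card V)"
  proof (cases "V = {}")
    case False
    then obtain v where "v \<in> V" by auto
    \<comment> \<open>Since \<epsilon> may exceed 1, the sign of this factor is taken from
      \<open>codeg\<close> at some vertex.\<close>
    from codeg[OF this] have "0 \<le> (1 - \<epsilon>) * card V"
      by (meson mult_nonneg_nonneg of_nat_0_le_iff order_trans)
    then show ?thesis using cardB by (intro mult_right_mono) (simp_all only: of_nat_le_iff)
  qed simp
  finally have 1: "real r * (card ?W' * (real T - t)) \<le> real r * (T * ((1 - \<epsilon>) * card V))" by simp
  have cW: "real (card ?W') = card V - real (card ?W)"
    using \<open>finite V\<close> by (simp add: card_Diff_subset of_nat_diff card_mono)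
  have "card ?W' * (T * (1 - \<epsilon> / 2)) \<le> card ?W' * (real T - t)"
    using T by (intro mult_left_mono) (auto simp: algebra_simps)
  also have "\<dots> \<le> T * ((1 - \<epsilon>) * card V)" using 1 \<open>0 < r\<close> by simp
  finally have "real T * (card ?W' * (1 - \<epsilon> / 2)) \<le> T * ((1 - \<epsilon>) * card V)"
    by (simp add: algebra_simps)
  then have "card ?W' * (1 - \<epsilon> / 2) \<le> (1 - \<epsilon>) * card V"
    using T(2) by simp
  then have "\<epsilon> / 2 * card V \<le> real (card ?W) * (1 - \<epsilon> / 2)"
    unfolding cW by (simp add: algebra_simps)
  also have "\<dots> \<le> card ?W" using \<open>0 < \<epsilon>\<close> by (simp add: algebra_simps)
  finally show ?thesis .
qed

text \<open>Minimum-degree form of Erdos--Stone, by induction on \<open>r\<close>: parts of size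
  \<open>T\<close> shrink to size \<open>t\<close> and gain a further one. Non-neighbours
  (\<open>v\<close> is one of its own) are counted with \<open>r\<close> as a factor, not a divisor,
  so the induction can start at \<open>r = 0\<close>, where any \<open>t\<close> vertices form the
  single part.\<close>

lemma erdos_stone_codegree:
  fixes \<epsilon> :: real
  assumes "0 < \<epsilon>"
  shows "\<exists>n\<^sub>0. \<forall>(V :: 'a set) E. finite V \<longrightarrow> n\<^sub>0 \<le> card V \<longrightarrow> E \<subseteq> [V]\<^bsup>2\<^esup> \<longrightarrow>
    (\<forall>v\<in>V. real r * card {u\<in>V. {v, u} \<notin> E} \<le> (1 - \<epsilon>) * card V) \<longrightarrow>
    (\<exists>A. multipartite V E (Suc r) t A)"
proof (induction r arbitrary: t)
  case 0
  show ?case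
  proof (intro exI[of _ t] allI impI)
    fix V :: "'a set" and E assume "t \<le> card V"
    then obtain S where "S \<subseteq> V" "card S = t" by (meson obtain_subset_with_card_n)
    then show "\<exists>A. multipartite V E (Suc 0) t A"
      by (intro exI[of _ "\<lambda>_. S"]) (auto simp: multipartite_def)
  qed
next
  case (Suc r)
  define T where "T = nat \<lceil>2 * t / \<epsilon>\<rceil> + 1"
  have "2 * t / \<epsilon> \<le> T" unfolding T_def by linarith
  then have T: "2 * t \<le> \<epsilon> * T" "0 < T" using assms by (auto simp: T_def field_simps)
  obtain n\<^sub>1 where n1: "\<And>(V :: 'a set) E. finite V \<Longrightarrow> n\<^sub>1 \<le> card V \<Longrightarrow> E \<subseteq> [V]\<^bsup>2\<^esup> \<Longrightarrow>
    (\<forall>v\<in>V. real r * card {u\<in>V. {v, u} \<notin> E} \<le> (1 - \<epsilon>) * card V) \<Longrightarrow>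
    (\<exists>A. multipartite V E (Suc r) T A)" using Suc.IH[of T] by blast
  define N where "N = (T choose t) ^ Suc r * t"
  \<comment> \<open>The second term makes \<open>\<epsilon> / 2 * card V\<close> exceed
    \<open>N\<close>, the threshold for adding a part.\<close>
  define n\<^sub>0 where "n\<^sub>0 = max n\<^sub>1 (nat \<lceil>2 * (N + 1) / \<epsilon>\<rceil>)"
  show ?case
  proof (intro exI[of _ n\<^sub>0] allI impI)
    fix V :: "'a set" and E
    assume V: "finite V" "n\<^sub>0 \<le> card V" "E \<subseteq> [V]\<^bsup>2\<^esup>"
      and codeg: "\<forall>v\<in>V. real (Suc r) * card {u\<in>V. {v, u} \<notin> E} \<le> (1 - \<epsilon>) * card V"
    have "real r * card {u\<in>V. {v, u} \<notin> E} \<le> (1 - \<epsilon>) * card V" if "v \<in> V" for v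
      using codeg[rule_format, OF that] by (simp add: distrib_right)
    then obtain A where A: "multipartite V E (Suc r) T A"
      using n1[of V E] V unfolding n\<^sub>0_def by (meson max.boundedE)
    let ?W = "{w \<in> V. \<forall>i<Suc r. t \<le> card {x \<in> A i. {w, x} \<in> E}}"
    have "2 * (N + 1) / \<epsilon> \<le> card V"
      using V(2) unfolding n\<^sub>0_def by linarith
    then have "real N + 1 \<le> \<epsilon> / 2 * card V" using assms by (simp add: field_simps)
    also have "\<dots> \<le> card ?W"
      by (rule many_well_connected[OF V(1) assms _ A T]) (use codeg in auto)
    finally have "N < card ?W" by linarith
    then show "\<exists>A. multipartite V E (Suc (Suc r)) t A"
      using multipartite_extend[OF V(1) A order_refl, of t] unfolding N_def by metis
  qed
qed

section \<open>From edge density to minimum degree\<close>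

lemma card_edges_at:
  assumes "E \<subseteq> [V]\<^bsup>2\<^esup>" "finite W" "v \<in> W"
  shows "card (E \<inter> Pow W) = card (E \<inter> Pow (W - {v})) + card {u \<in> W. {v, u} \<in> E}"
proof -
  have eq: "E \<inter> Pow W = (E \<inter> Pow (W - {v})) \<union> (\<lambda>u. {v, u}) ` {u \<in> W. {v, u} \<in> E}" (is "_ = ?X \<union> ?Y")
  proof (intro equalityI subsetI)
    fix e assume e: "e \<in> E \<inter> Pow W"
    then obtain a b where "e = {a, b}" using assms(1) by (auto simp: nsets_def card_2_iff)
    with e show "e \<in> ?X \<union> ?Y"
      by (cases "a = v"; cases "b = v") (auto simp: insert_commute)
  qed (use assms in auto)
  have "card ?Y = card {u \<in> W. {v, u} \<in> E}"
    by (rule card_image) (auto simp: inj_on_def doubleton_eq_iff)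
  moreover have "card (?X \<union> ?Y) = card ?X + card ?Y"
    using assms by (intro card_Un_disjoint) auto
  ultimately show ?thesis by (simp only: eq)
qed

lemma card_split_Collect:
  assumes "finite W"
  shows "card W = card {u \<in> W. P u} + card {u \<in> W. \<not> P u}"
proof -
  have "card ({u \<in> W. P u} \<union> {u \<in> W. \<not> P u}) = card {u \<in> W. P u} + card {u \<in> W. \<not> P u}"
    using assms by (intro card_Un_disjoint) auto
  moreover have "{u \<in> W. P u} \<union> {u \<in> W. \<not> P u} = W" by auto
  ultimately show ?thesis by simp
qed

text \<open>Passing from the maximiser \<open>W\<close> to \<open>W - {v}\<close> loses the degree
  of \<open>v\<close> in \<open>W\<close> and lowers the binomial by exactly \<open>card W\<close>,
  which is why it has \<open>Suc\<close>; maximality therefore bounds the degree from below.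
  Comparison with \<open>V\<close> yields the last inequality.\<close>

lemma dense_subgraph_min_degree:
  fixes \<alpha> :: real
  assumes "finite V" "E \<subseteq> [V]\<^bsup>2\<^esup>"
  obtains W where "W \<subseteq> V" "\<And>v. v \<in> W \<Longrightarrow> \<alpha> * card W \<le> card {u \<in> W. {v, u} \<in> E}"
    "card E - \<alpha> * (Suc (card V) choose 2) \<le> card (E \<inter> Pow W) - \<alpha> * (Suc (card W) choose 2)"
proof -
  define f where "f W = card (E \<inter> Pow W) - \<alpha> * (Suc (card W) choose 2)" for W
  have fin: "finite (f ` Pow V)" "f ` Pow V \<noteq> {}" using assms(1) by auto
  obtain W where W: "W \<subseteq> V" "f W = Max (f ` Pow V)" using Max_in[OF fin] by auto
  have max: "f U \<le> f W" if "U \<subseteq> V" for U using W fin that by auto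
  have finW: "finite W" using W assms by (auto intro: finite_subset)
  have "\<alpha> * card W \<le> card {u \<in> W. {v, u} \<in> E}" if "v \<in> W" for v
  proof -
    have "f (W - {v}) \<le> f W" using W by (intro max) auto
    moreover have "Suc (card (W - {v})) = card W" by (rule card_Suc_Diff1[OF finW that])
    ultimately show ?thesis
      using card_edges_at[OF assms(2) finW that]
      by (simp add: f_def algebra_simps choose_two numeral_2_eq_2)
  qed
  moreover have "E \<inter> Pow V = E" using assms(2) by (auto simp: nsets_def)
  then have "card E - \<alpha> * (Suc (card V) choose 2) \<le> f W" using max[of V] by (simp add: f_def)
  ultimately show ?thesis using that[OF W(1)] by (simp add: f_def)
qed

lemma real_choose_two: "real (n choose 2) = n * (real n - 1) / 2"
proof (induction n)
  case (Suc n)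
  have "Suc n choose 2 = n + (n choose 2)" by (simp add: numeral_2_eq_2)
  then have "real (Suc n choose 2) = n + n * (real n - 1) / 2" by (simp add: Suc)
  also have "\<dots> = real (Suc n) * (real (Suc n) - 1) / 2" by (simp add: field_simps)
  finally show ?case .
qed simp

theorem erdos_stone:
  fixes \<epsilon> :: real
  assumes "0 < \<epsilon>" "0 < s"
  shows "\<exists>n\<^sub>0. \<forall>(V :: 'a set) E. finite V \<longrightarrow> n\<^sub>0 \<le> card V \<longrightarrow> E \<subseteq> [V]\<^bsup>2\<^esup> \<longrightarrow>
    (1 - 1 / real s + \<epsilon>) * (card V choose 2) \<le> card E \<longrightarrow> (\<exists>A. multipartite V E (Suc s) t A)"
proof -
  obtain m where m: "\<And>(V :: 'a set) E. finite V \<Longrightarrow> m \<le> card V \<Longrightarrow> E \<subseteq> [V]\<^bsup>2\<^esup> \<Longrightarrow>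
    (\<forall>v\<in>V. real s * card {u\<in>V. {v, u} \<notin> E} \<le> (1 - \<epsilon> / 2) * card V) \<Longrightarrow>
    (\<exists>A. multipartite V E (Suc s) t A)"
    using erdos_stone_codegree[OF half_gt_zero[OF assms(1)], where r = s and t = t and 'a = 'a] by blast
  \<comment> \<open>The excess \<epsilon> is split: one half goes into the minimum degree in
    \<open>W\<close>, the other forces \<open>W\<close> to be large.\<close>
  define \<alpha> where "\<alpha> = 1 - 1 / real s + \<epsilon> / 2"
  have "1 / real s \<le> 1" using assms(2) by simp
  then have \<alpha>: "0 < \<alpha>" using assms(1) unfolding \<alpha>_def by linarith
  \<comment> \<open>Chosen so that \<open>m ^ 2 + \<alpha> < \<epsilon> / 4 * (n - 1)\<close> for
    all \<open>n \<ge> n\<^sub>0\<close>.\<close>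
  define n\<^sub>0 where "n\<^sub>0 = nat \<lceil>4 * (m ^ 2 + \<alpha>) / \<epsilon>\<rceil> + 2"
  show ?thesis
  proof (intro exI[of _ n\<^sub>0] allI impI)
    fix V :: "'a set" and E
    assume V: "finite V" "n\<^sub>0 \<le> card V" "E \<subseteq> [V]\<^bsup>2\<^esup>"
      and dense: "(1 - 1 / real s + \<epsilon>) * (card V choose 2) \<le> card E"
    obtain W where W: "W \<subseteq> V" "\<And>v. v \<in> W \<Longrightarrow> \<alpha> * card W \<le> card {u \<in> W. {v, u} \<in> E}"
      "card E - \<alpha> * (Suc (card V) choose 2) \<le> card (E \<inter> Pow W) - \<alpha> * (Suc (card W) choose 2)"
      using dense_subgraph_min_degree[OF V(1,3), of \<alpha>] by blast
    have finW: "finite W" using W(1) V(1) by (rule finite_subset)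
    have sub: "E \<inter> Pow W \<subseteq> [W]\<^bsup>2\<^esup>" using V(3) by (auto simp: nsets_def)
    \<comment> \<open>A small \<open>W\<close> spans at most \<open>m ^ 2\<close> edges. The density
      of \<open>E\<close> exceeds \<alpha> by at least \<open>\<epsilon> / 2\<close>, and this
      surplus, quadratic in \<open>n = card V\<close>, beats
      \<open>m ^ 2 + \<alpha> * n\<close>.\<close>
    have "m \<le> card W"
    proof (rule ccontr)
      assume "\<not> m \<le> card W"
      then have cW: "card W \<le> m" by simp
      let ?n = "real (card V)"
      have "card (E \<inter> Pow W) \<le> card W choose 2"
        using card_mono[OF finite_imp_finite_nsets[OF finW] sub] by (simp add: card_nsets)
      also have "\<dots> \<le> card W ^ 2" by (rule order_trans[OF _ binomial_fact_pow]) simp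
      also have "\<dots> \<le> m ^ 2" using cW by (rule power_mono) simp
      finally have "card (E \<inter> Pow W) \<le> m ^ 2" .
      then have "real (card (E \<inter> Pow W)) \<le> real m ^ 2" by (metis of_nat_le_iff of_nat_power)
      moreover have "0 \<le> \<alpha> * (Suc (card W) choose 2)" using \<alpha> by simp
      ultimately have "card E \<le> real m ^ 2 + \<alpha> * (Suc (card V) choose 2)" using W(3) by linarith
      moreover have "(\<alpha> + \<epsilon> / 2) * (card V choose 2) \<le> card E"
        using dense by (simp add: \<alpha>_def add.commute)
      ultimately have "(\<alpha> + \<epsilon> / 2) * (card V choose 2) \<le> real m ^ 2 + \<alpha> * (Suc (card V) choose 2)"
        by linarith
      then have le: "\<epsilon> / 4 * (?n * (?n - 1)) \<le> real m ^ 2 + \<alpha> * ?n"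
        by (simp add: real_choose_two algebra_simps add_divide_distrib diff_divide_distrib)
      have n: "4 * (m ^ 2 + \<alpha>) / \<epsilon> + 2 \<le> ?n" using V(2) unfolding n\<^sub>0_def by linarith
      then have "real m ^ 2 + \<alpha> < \<epsilon> / 4 * (?n - 1)" using assms(1) by (simp add: field_simps)
      moreover have "1 \<le> ?n" using V(2) by (simp add: n\<^sub>0_def)
      ultimately have "(real m ^ 2 + \<alpha>) * ?n < \<epsilon> / 4 * (?n - 1) * ?n" by simp
      moreover have "real m ^ 2 * 1 \<le> real m ^ 2 * ?n" using \<open>1 \<le> ?n\<close> by (intro mult_left_mono) auto
      ultimately show False using le by (simp add: algebra_simps)
    qed
    moreover have "real s * card {u\<in>W. {v, u} \<notin> E \<inter> Pow W} \<le> (1 - \<epsilon> / 2) * card W" if v: "v \<in> W" for v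
    proof -
      have "{u\<in>W. {v, u} \<notin> E \<inter> Pow W} = {u\<in>W. {v, u} \<notin> E}" using v by auto
      moreover have "card W = card {u\<in>W. {v, u} \<in> E} + card {u\<in>W. {v, u} \<notin> E}"
        using finW by (rule card_split_Collect)
      ultimately have "real (card {u\<in>W. {v, u} \<notin> E \<inter> Pow W}) \<le> (1 - \<alpha>) * card W"
        using W(2)[OF v] by (simp add: algebra_simps)
      then have "real s * card {u\<in>W. {v, u} \<notin> E \<inter> Pow W} \<le> real s * ((1 - \<alpha>) * card W)"
        by (rule mult_left_mono) simp
      also have "\<dots> = (1 - s * \<epsilon> / 2) * card W" using assms(2) by (simp add: \<alpha>_def field_simps)
      also have "\<dots> \<le> (1 - \<epsilon> / 2) * card W" using assms by (intro mult_right_mono) auto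
      finally show ?thesis .
    qed
    ultimately obtain A where "multipartite W (E \<inter> Pow W) (Suc s) t A"
      using m[OF finW _ sub] by blast
    then have "multipartite V E (Suc s) t A" using W(1) unfolding multipartite_def by blast
    then show "\<exists>A. multipartite V E (Suc s) t A" by blast
  qed
qed

subsection \<open>The bootstrap percolation process\<close>

lemma is_graphD:
  assumes "is_graph G"
  shows "finite (verts G)" "finite (edges G)" "edges G \<subseteq> [verts G]\<^bsup>2\<^esup>"
  using assms by (auto simp: is_graph_def intro: finite_subset finite_imp_finite_nsets)

lemma is_graph_edgeD:
  assumes "is_graph G" "{x, y} \<in> edges G"
  shows "x \<in> verts G" "y \<in> verts G" "x \<noteq> y"
  using subsetD[OF is_graphD(3)[OF assms(1)] assms(2)] unfolding doubleton_mem_nsets_2 by blast+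

lemma is_graph_edgeE:
  assumes "is_graph G" "f \<in> edges G"
  obtains x y where "f = {x, y}"
  using subsetD[OF is_graphD(3)[OF assms(1)] assms(2)] by (auto simp: nsets_def card_2_iff)

text \<open>A copy is determined by its vertex and edge sets. As \<open>card\<close> is 0 on
  infinite sets, finiteness is what turns a strictly larger set of copies into a larger
  count.\<close>

lemma finite_copies:
  assumes "is_graph H"
  shows "finite (copies F H)"
proof (rule finite_subset)
  show "copies F H \<subseteq> (\<lambda>(V, E). \<lparr>verts = V, edges = E\<rparr>) ` (Pow (verts H) \<times> Pow (edges H))"
  proof
    fix C assume "C \<in> copies F H"
    then have "verts C \<subseteq> verts H" "edges C \<subseteq> edges H" by (auto simp: copies_def subgraph_def)
    then show "C \<in> (\<lambda>(V, E). \<lparr>verts = V, edges = E\<rparr>) ` (Pow (verts H) \<times> Pow (edges H))"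
      by (intro rev_image_eqI[of "(verts C, edges C)"]) auto
  qed
qed (use is_graphD[OF assms] in auto)

lemma verts_process_step [simp]: "verts (process_step F H) = verts H"
  by (simp add: process_step_def)

lemma edges_process_step: "edges H \<subseteq> edges (process_step F H)"
  by (auto simp: process_step_def)

lemma is_graph_process_step: "is_graph H \<Longrightarrow> is_graph (process_step F H)"
  by (auto simp: process_step_def is_graph_def)

lemma verts_process [simp]: "verts (process F H i) = verts H"
  by (induction i) auto

lemma is_graph_process: "is_graph H \<Longrightarrow> is_graph (process F H i)"
  by (induction i) (auto intro: is_graph_process_step)

lemma edges_process_mono: "i \<le> j \<Longrightarrow> edges (process F H i) \<subseteq> edges (process F H j)"
  by (rule lift_Suc_mono_le[of "\<lambda>i. edges (process F H i)"]) (auto intro: edges_process_step[THEN subsetD])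

section \<open>Completing the missing edge of a copy\<close>

text \<open>The image of \<open>F\<close> is a copy once the image of \<open>e\<close> is added, but
  not before if that pair is missing. Copies present earlier survive, so their finite number
  strictly grows and the step adds the pair.\<close>

lemma embedding_completes_edge:
  assumes H: "is_graph H" and F: "is_graph F" "e \<in> edges F"
    and \<phi>: "inj_on \<phi> (verts F)" "\<phi> ` verts F \<subseteq> verts H"
    and edges: "\<And>f. f \<in> edges F \<Longrightarrow> f \<noteq> e \<Longrightarrow> \<phi> ` f \<in> edges H"
  shows "\<phi> ` e \<in> edges (process_step F H)"
proof (cases "\<phi> ` e \<in> edges H")
  case True
  then show ?thesis using edges_process_step by blast
next
  case False
  have pairs: "\<phi> ` f \<in> [\<phi> ` verts F]\<^bsup>2\<^esup>" if "f \<in> edges F" for f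
  proof -
    have f: "f \<subseteq> verts F" "finite f" "card f = 2"
      using that is_graphD(3)[OF F(1)] by (auto simp: nsets_def)
    then have "card (\<phi> ` f) = 2" using \<phi>(1) by (simp add: card_image inj_on_subset)
    then show ?thesis using f by (auto simp: nsets_def)
  qed
  let ?H = "add_edge H (\<phi> ` e)"
  define C where "C = \<lparr>verts = \<phi> ` verts F, edges = (\<lambda>f. \<phi> ` f) ` edges F\<rparr>"
  have pair: "\<phi> ` e \<in> [verts H]\<^bsup>2\<^esup>"
    using pairs[OF F(2)] \<phi>(2) unfolding nsets_def by blast
  then have graph: "is_graph ?H" using H by (auto simp: is_graph_def add_edge_def)
  have "is_graph C" using pairs is_graphD(1)[OF F(1)] by (auto simp: is_graph_def C_def)
  moreover have "isomorphic F C"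
    unfolding isomorphic_def C_def using \<phi>(1) by (intro exI[of _ \<phi>]) (auto simp: bij_betw_def)
  ultimately have "C \<in> copies F ?H"
    using \<phi>(2) edges by (auto simp: copies_def subgraph_def C_def add_edge_def)
  moreover have "C \<notin> copies F H" using False F(2) by (auto simp: copies_def subgraph_def C_def)
  moreover have "copies F H \<subseteq> copies F ?H" by (auto simp: copies_def subgraph_def add_edge_def)
  ultimately have "copies F H \<subset> copies F ?H" by blast
  then have "num_copies F H < num_copies F ?H"
    unfolding num_copies_def by (rule psubset_card_mono[OF finite_copies[OF graph]])
  then show ?thesis using pair by (simp add: process_step_def)
qed

text \<open>Greedy choice: fewer than \<open>card S\<close> elements are taken before each new one,
  so every \<open>B w\<close> still offers a free element.\<close>

lemma distinct_representatives:
  assumes "finite S" "\<And>w. w \<in> S \<Longrightarrow> card S \<le> card (B w)"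
  shows "\<exists>\<phi>. inj_on \<phi> S \<and> (\<forall>w\<in>S. \<phi> w \<in> B w)"
  using assms
proof (induction S)
  case (insert s S)
  then obtain \<phi> where \<phi>: "inj_on \<phi> S" "\<forall>w\<in>S. \<phi> w \<in> B w" by fastforce
  have "card (\<phi> ` S) < card (B s)"
    using insert.prems[of s] insert.hyps card_image_le[of S \<phi>] by simp
  then have "\<not> B s \<subseteq> \<phi> ` S" using insert.hyps card_mono[of "\<phi> ` S" "B s"] by auto
  then obtain b where "b \<in> B s" "b \<notin> \<phi> ` S" by blast
  then have "inj_on (\<phi>(s := b)) (insert s S) \<and> (\<forall>w\<in>insert s S. (\<phi>(s := b)) w \<in> B w)"
    using \<phi> insert.hyps by (auto simp: inj_on_def)
  then show ?case by blast
qed simp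

text \<open>Fixing \<open>p\<close> and \<open>q\<close> in advance removes two elements from
  \<open>S\<close> and at most two from each candidate set, so the greedy choice still works for the
  rest.\<close>

lemma distinct_representatives_extending:
  assumes "finite S" "u \<in> S" "v \<in> S" "u \<noteq> v" "p \<noteq> q" "p \<in> B u" "q \<in> B v"
    and card: "\<And>w. w \<in> S \<Longrightarrow> card S \<le> card (B w)"
  obtains \<phi> where "inj_on \<phi> S" "\<forall>w\<in>S. \<phi> w \<in> B w" "\<phi> u = p" "\<phi> v = q"
proof -
  have "card (S - {u, v}) = card S - 2"
    using assms by (simp add: card_Diff_subset)
  moreover have "card (B w) - 2 \<le> card (B w - {p, q})" for w
    using diff_card_le_card_Diff[of "{p, q}" "B w"] \<open>p \<noteq> q\<close> by simp
  ultimately have "card (S - {u, v}) \<le> card (B w - {p, q})" if "w \<in> S - {u, v}" for w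
    using card[of w] that by (metis Diff_iff diff_le_mono le_trans)
  then obtain \<psi> where \<psi>: "inj_on \<psi> (S - {u, v})" "\<forall>w\<in>S - {u, v}. \<psi> w \<in> B w - {p, q}"
    using distinct_representatives[of "S - {u, v}" "\<lambda>w. B w - {p, q}"] \<open>finite S\<close> by auto
  let ?\<phi> = "\<psi>(u := p, v := q)"
  have avoid: "\<psi> w \<noteq> p" "\<psi> w \<noteq> q" if "w \<in> S" "w \<noteq> u" "w \<noteq> v" for w
    using \<psi>(2) that by auto
  have "inj_on ?\<phi> S"
  proof (rule inj_onI)
    fix w w' assume *: "w \<in> S" "w' \<in> S" "?\<phi> w = ?\<phi> w'"
    show "w = w'"
    proof (cases "w \<in> {u, v} \<or> w' \<in> {u, v}")
      case True
      then show ?thesis using * avoid[of w] avoid[of w'] \<open>p \<noteq> q\<close> by (auto split: if_splits)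
    next
      case False
      then show ?thesis using * inj_onD[OF \<psi>(1), of w w'] by simp
    qed
  qed
  moreover have "\<forall>w\<in>S. ?\<phi> w \<in> B w" using \<psi>(2) assms by simp
  ultimately show ?thesis by (rule that) (use \<open>u \<noteq> v\<close> in simp_all)
qed

text \<open>\<open>B w\<close> holds the allowed images of a vertex \<open>w\<close> of
  \<open>F\<close>, enough of them to choose an injection that sends \<open>u\<close> and
  \<open>v\<close> to \<open>p\<close> and \<open>q\<close>. Injectivity keeps every other edge of
  \<open>F\<close> off \<open>{p, q}\<close>.\<close>

lemma process_step_completes_pair:
  assumes K: "is_graph K" and F: "is_graph F" "{u, v} \<in> edges F"
    and B: "\<And>w. w \<in> verts F \<Longrightarrow> B w \<subseteq> verts K \<and> card (verts F) \<le> card (B w)"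
    and pq: "p \<in> B u" "q \<in> B v" "p \<noteq> q"
    and edges: "\<And>w w' x y. {w, w'} \<in> edges F \<Longrightarrow> {w, w'} \<noteq> {u, v} \<Longrightarrow> x \<in> B w \<Longrightarrow> y \<in> B w' \<Longrightarrow>
      x \<noteq> y \<Longrightarrow> {x, y} \<noteq> {p, q} \<Longrightarrow> {x, y} \<in> edges K"
  shows "{p, q} \<in> edges (process_step F K)"
proof -
  obtain \<phi> where \<phi>: "inj_on \<phi> (verts F)" "\<forall>w\<in>verts F. \<phi> w \<in> B w" "\<phi> u = p" "\<phi> v = q"
    by (rule distinct_representatives_extending[of "verts F" u v p q B])
      (use is_graphD(1)[OF F(1)] is_graph_edgeD[OF F] B pq in blast)+
  have "\<phi> ` {u, v} \<in> edges (process_step F K)"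
  proof (rule embedding_completes_edge[OF K F \<phi>(1)])
    show "\<phi> ` verts F \<subseteq> verts K" using \<phi>(2) B by blast
    fix f assume f: "f \<in> edges F" "f \<noteq> {u, v}"
    obtain w w' where ww: "f = {w, w'}" using is_graph_edgeE[OF F(1) f(1)] .
    have mem: "w \<in> verts F" "w' \<in> verts F" "w \<noteq> w'"
      using is_graph_edgeD[OF F(1)] f(1) ww by auto
    have "\<phi> ` f \<noteq> \<phi> ` {u, v}"
      using inj_on_image_eq_iff[OF \<phi>(1), of f "{u, v}"] f(2) mem is_graph_edgeD[OF F] unfolding ww by blast
    then have "{\<phi> w, \<phi> w'} \<noteq> {p, q}" by (simp add: ww \<phi>)
    moreover have "\<phi> w \<noteq> \<phi> w'" using inj_on_eq_iff[OF \<phi>(1)] mem by blast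
    moreover have "\<phi> w \<in> B w" "\<phi> w' \<in> B w'" using \<phi>(2) mem by blast+
    ultimately have "{\<phi> w, \<phi> w'} \<in> edges K"
      using f unfolding ww by (intro edges[of w w'])
    then show "\<phi> ` f \<in> edges K" by (simp add: ww)
  qed
  then show ?thesis by (simp add: \<phi>)
qed

section \<open>Two steps in a nearly complete multipartite graph\<close>

lemma proper_colouring_permute:
  assumes "proper_colouring G r c" "bij_betw \<pi> {..<r} {..<r}" "is_graph G"
  shows "proper_colouring G r (\<pi> \<circ> c)"
proof -
  have "\<pi> (c x) \<noteq> \<pi> (c y)" if "{x, y} \<in> edges G" for x y
  proof -
    have "c x \<in> {..<r}" "c y \<in> {..<r}" "c x \<noteq> c y"
      using assms(1) is_graph_edgeD[OF assms(3) that] that unfolding proper_colouring_def by blast+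
    then show ?thesis using inj_on_eq_iff[OF bij_betw_imp_inj_on[OF assms(2)]] by blast
  qed
  moreover have "\<pi> (c x) < r" if "x \<in> verts G" for x
  proof -
    have "c x \<in> {..<r}" using assms(1) that unfolding proper_colouring_def by blast
    then show ?thesis using bij_betwE[OF assms(2)] by blast
  qed
  ultimately show ?thesis unfolding proper_colouring_def by auto
qed

text \<open>One transposition brings \<open>a\<close> to \<open>i\<close>; a second exchanges the
  new place of \<open>b\<close> with \<open>j\<close>. The second fixes \<open>i\<close>: it is the
  identity if \<open>a = b\<close>, and otherwise \<open>i\<close> differs from both swapped
  points.\<close>

lemma obtain_permutation2:
  fixes a b i j r :: nat
  assumes "a < r" "b < r" "i < r" "j < r" "a = b \<longleftrightarrow> i = j"
  obtains \<pi> where "bij_betw \<pi> {..<r} {..<r}" "\<pi> a = i" "\<pi> b = j"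
proof -
  let ?\<sigma> = "transpose a i"
  let ?\<pi> = "transpose (?\<sigma> b) j \<circ> ?\<sigma>"
  have "bij_betw ?\<sigma> {..<r} {..<r}" using assms by (simp add: bij_betw_transpose_iff)
  moreover have "?\<sigma> b < r" using assms by (auto simp: transpose_def)
  ultimately have "bij_betw ?\<pi> {..<r} {..<r}"
    using assms by (intro bij_betw_trans) (auto simp: bij_betw_transpose_iff)
  moreover have "?\<pi> a = i" "?\<pi> b = j" using assms by (auto simp: transpose_def)
  ultimately show ?thesis by (rule that)
qed

lemma is_graph_del_edge: "is_graph G \<Longrightarrow> is_graph (del_edge G e)"
  by (auto simp: is_graph_def del_edge_def)

text \<open>Colour classes of \<open>F\<close> without its edge \<open>{u, v}\<close> are embedded
  into the parts. If \<open>u\<close> and \<open>v\<close> differ in colour, renaming these colours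
  to \<open>a\<close> and \<open>b\<close> yields \<open>{x, y}\<close> in one step. If they agree,
  the first step fills each part and the second adds \<open>{x, y}\<close>. The spare vertex per
  part makes up for one end of \<open>{x, y}\<close> deleted during the filling.\<close>

lemma two_steps_complete_multipartite:
  assumes K: "is_graph K" and F: "is_graph F" "{u, v} \<in> edges F"
    and c: "proper_colouring (del_edge F {u, v}) r c"
    and B: "\<And>i. i < r \<Longrightarrow> B i \<subseteq> verts K \<and> card (verts F) + 1 \<le> card (B i)"
    and cross: "\<And>i j p q. i < r \<Longrightarrow> j < r \<Longrightarrow> i \<noteq> j \<Longrightarrow> p \<in> B i \<Longrightarrow> q \<in> B j \<Longrightarrow> {p, q} \<noteq> {x, y} \<Longrightarrow> {p, q} \<in> edges K"
    and xy: "a < r" "b < r" "a \<noteq> b" "x \<in> B a" "y \<in> B b" "x \<noteq> y"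
  shows "{x, y} \<in> edges (process_step F (process_step F K))"
proof -
  have uv: "u \<in> verts F" "v \<in> verts F" using is_graph_edgeD[OF F] by auto
  have cr: "c' w < r" if "proper_colouring (del_edge F {u, v}) r c'" "w \<in> verts F" for c' w
    using that by (auto simp: proper_colouring_def del_edge_def)
  have cne: "c' w \<noteq> c' w'" if "proper_colouring (del_edge F {u, v}) r c'" "{w, w'} \<in> edges F" "{w, w'} \<noteq> {u, v}" for c' w w'
    using that by (auto simp: proper_colouring_def del_edge_def)
  have recolour: "\<exists>c'. proper_colouring (del_edge F {u, v}) r c' \<and> c' u = i \<and> c' v = j"
    if ij: "i < r" "j < r" "c u = c v \<longleftrightarrow> i = j" for i j
  proof -
    obtain \<pi> where "bij_betw \<pi> {..<r} {..<r}" "\<pi> (c u) = i" "\<pi> (c v) = j"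
      using obtain_permutation2[OF cr[OF c uv(1)] cr[OF c uv(2)] ij] .
    with proper_colouring_permute[OF c] is_graph_del_edge[OF F(1)] show ?thesis
      by (intro exI[of _ "\<pi> \<circ> c"]) auto
  qed
  show ?thesis
  proof (cases "c u = c v")
    case False
    then obtain c' where c': "proper_colouring (del_edge F {u, v}) r c'" "c' u = a" "c' v = b"
      using recolour[of a b] xy by auto
    have "{x, y} \<in> edges (process_step F K)"
    proof (rule process_step_completes_pair[OF K F, of "\<lambda>w. B (c' w)"])
      fix w w' p q
      assume *: "{w, w'} \<in> edges F" "{w, w'} \<noteq> {u, v}" "p \<in> B (c' w)" "q \<in> B (c' w')" "{p, q} \<noteq> {x, y}"
      have "c' w < r" "c' w' < r" using cr[OF c'(1)] is_graph_edgeD[OF F(1) *(1)] by blast+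
      then show "{p, q} \<in> edges K" by (rule cross[OF _ _ cne[OF c'(1) *(1,2)] *(3-5)])
    next
      fix w assume "w \<in> verts F"
      then show "B (c' w) \<subseteq> verts K \<and> card (verts F) \<le> card (B (c' w))"
        using B[OF cr[OF c'(1)]] by force
    qed (use c' xy in simp_all)
    then show ?thesis using edges_process_step by blast
  next
    case True
    have disj: "p \<notin> B j" if "i < r" "j < r" "i \<noteq> j" "p \<in> B i" for i j p
      using cross[of i j p p] is_graph_edgeD(3)[OF K, of p p] that xy(6) by auto
    have same: "{p, q} \<in> edges (process_step F K)" if pq: "i < r" "p \<in> B i" "q \<in> B i" "p \<noteq> q" for i p q
    proof -
      obtain c' where c': "proper_colouring (del_edge F {u, v}) r c'" "c' u = i" "c' v = i"
        using recolour[of i i] pq True by auto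
      \<comment> \<open>An end of the exceptional pair outside \<open>B i\<close>. Deleting it from
        the candidates keeps every embedding clear of \<open>{x, y}\<close> without losing
        \<open>p\<close> or \<open>q\<close>.\<close>
      define z where "z = (if i = a then y else x)"
      have z: "z \<notin> B i" "z = x \<or> z = y" using disj[of b a y] disj[of a i x] xy pq by (auto simp: z_def)
      show ?thesis
      proof (rule process_step_completes_pair[OF K F, of "\<lambda>w. B (c' w) - {z}"])
        fix w assume "w \<in> verts F"
        then have "B (c' w) \<subseteq> verts K \<and> card (verts F) + 1 \<le> card (B (c' w))" using B cr[OF c'(1)] by blast
        moreover have "card (B (c' w)) - 1 \<le> card (B (c' w) - {z})"
          using diff_card_le_card_Diff[of "{z}" "B (c' w)"] by simp
        ultimately show "B (c' w) - {z} \<subseteq> verts K \<and> card (verts F) \<le> card (B (c' w) - {z})" by auto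
      next
        fix w w' p' q'
        assume *: "{w, w'} \<in> edges F" "{w, w'} \<noteq> {u, v}" "p' \<in> B (c' w) - {z}" "q' \<in> B (c' w') - {z}"
        have "z \<notin> {p', q'}" using *(3,4) by blast
        then have ne: "{p', q'} \<noteq> {x, y}" using z(2) by blast
        have "c' w < r" "c' w' < r" using cr[OF c'(1)] is_graph_edgeD[OF F(1) *(1)] by blast+
        moreover have "p' \<in> B (c' w)" "q' \<in> B (c' w')" using *(3,4) by blast+
        ultimately show "{p', q'} \<in> edges K" using ne by (rule cross[OF _ _ cne[OF c'(1) *(1,2)]])
      next
        show "p \<in> B (c' u) - {z}" "q \<in> B (c' v) - {z}" "p \<noteq> q" using pq c' z by auto
      qed
    qed
    show ?thesis
    \<comment> \<open>After one step the union of the parts is a clique except perhaps for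
      \<open>{x, y}\<close>, so colours no longer matter and every vertex of \<open>F\<close> may go
      anywhere in it.\<close>
    proof (rule process_step_completes_pair[OF is_graph_process_step[OF K] F, of "\<lambda>_. \<Union>i<r. B i"])
      fix w
      have "finite (\<Union>i<r. B i)" using B is_graphD(1)[OF K] by (auto intro: finite_subset)
      then have "card (B a) \<le> card (\<Union>i<r. B i)" using xy by (intro card_mono) auto
      then have "card (verts F) \<le> card (\<Union>i<r. B i)" using B[OF xy(1)] by linarith
      then show "(\<Union>i<r. B i) \<subseteq> verts (process_step F K) \<and> card (verts F) \<le> card (\<Union>i<r. B i)"
        using B by auto
    next
      fix w w' p q
      assume *: "p \<in> (\<Union>i<r. B i)" "q \<in> (\<Union>i<r. B i)" "p \<noteq> q" "{p, q} \<noteq> {x, y}"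
      then obtain i j where ij: "i < r" "j < r" "p \<in> B i" "q \<in> B j" by auto
      show "{p, q} \<in> edges (process_step F K)"
      proof (cases "i = j")
        case True then show ?thesis using same ij * by blast
      next
        case False then show ?thesis using cross[OF ij(1,2) _ ij(3,4)] * edges_process_step by blast
      qed
    qed (use xy in auto)
  qed
qed

section \<open>No large complete multipartite graph among the new edges\<close>

text \<open>Let \<open>g j = {x, y}\<close> be the last chosen edge between different parts. Once
  the other ends of \<open>g (j - 1)\<close> and \<open>g (j - 2)\<close> are discarded, all
  remaining edges between parts have index at most \<open>j - 3\<close>, so they are present at
  stage \<open>j - 2\<close>. Of the 6 spare vertices per part up to 4 are discarded; the other two
  cover the margin in \<open>two_steps_complete_multipartite\<close> and a vertex of
  \<open>B a\<close> besides \<open>x\<close>.\<close>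

lemma not_multipartite_new_edges:
  assumes H: "is_graph H" and F: "is_graph F" "{u, v} \<in> edges F"
    and c: "proper_colouring (del_edge F {u, v}) r c"
    and g: "\<And>i. i < k \<Longrightarrow> g i \<in> edges (process F H (Suc i)) - edges (process F H i)"
    and r: "2 \<le> r"
  shows "\<not> multipartite (verts H) (g ` {..<k}) r (card (verts F) + 6) A"
proof
  let ?t = "card (verts F) + 6"
  assume A: "multipartite (verts H) (g ` {..<k}) r ?t A"
  define X where "X = {l. l < k \<and> (\<exists>i<r. \<exists>j<r. i \<noteq> j \<and> (\<exists>p\<in>A i. \<exists>q\<in>A j. g l = {p, q}))}"
  have X: "\<exists>l\<in>X. {p, q} = g l" if "i < r" "j < r" "i \<noteq> j" "p \<in> A i" "q \<in> A j" for i j p q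
  proof -
    have "{p, q} \<in> g ` {..<k}" using A that unfolding multipartite_def by blast
    then obtain l where "l < k" "{p, q} = g l" by auto
    then have "l \<in> X" using that unfolding X_def mem_Collect_eq by metis
    then show ?thesis using \<open>{p, q} = g l\<close> by blast
  qed
  have A': "A i \<subseteq> verts H" "card (A i) = ?t" if "i < r" for i
    using A that by (auto simp: multipartite_def)
  have "A 0 \<noteq> {}" "A 1 \<noteq> {}" using A'[of 0] A'[of 1] r by auto
  then obtain p q where "p \<in> A 0" "q \<in> A 1" by auto
  then have "X \<noteq> {}" using X[of 0 1 p q] r by auto
  moreover have finX: "finite X" by (rule finite_subset[of _ "{..<k}"]) (auto simp: X_def)
  ultimately have "Max X \<in> X" by (intro Max_in)
  define j where "j = Max X"
  have jmax: "l \<le> j" if "l \<in> X" for l using that finX by (simp add: j_def)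
  have "j \<in> X" unfolding j_def by fact
  then have jk: "j < k" and "\<exists>a<r. \<exists>b<r. a \<noteq> b \<and> (\<exists>x\<in>A a. \<exists>y\<in>A b. g j = {x, y})"
    unfolding X_def mem_Collect_eq by (rule conjunct1, rule conjunct2)
  from this(2) obtain a b x y where xy: "a < r" "b < r" "a \<noteq> b" "x \<in> A a" "y \<in> A b" "g j = {x, y}"
    by (elim exE conjE bexE)
  have pair: "\<exists>p q. p \<noteq> q \<and> g i = {p, q}" if "i < k" for i
  proof -
    have gi: "g i \<in> edges (process F H (Suc i))" using g[OF that] by blast
    obtain p q where "g i = {p, q}"
      using is_graph_edgeE[OF is_graph_process[OF H] gi] .
    then show ?thesis using is_graph_edgeD(3)[OF is_graph_process[OF H]] gi by metis
  qed
  have "x \<noteq> y" using pair[OF jk] xy(6) by (auto simp: doubleton_eq_iff)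
  \<comment> \<open>\<open>x\<close> and \<open>y\<close> are kept even if they occur in these
    edges: a pair disjoint from \<open>D\<close> and contained in
    \<open>g (j - 1) \<union> g (j - 2)\<close> can only be \<open>{x, y}\<close>. For small
    \<open>j\<close> the truncated indices are still below \<open>k\<close>.\<close>
  define D where "D = g (j - 1) \<union> g (j - 2) - {x, y}"
  have card2: "finite (g i) \<and> card (g i) = 2" if "i < k" for i using pair[OF that] by auto
  have D: "finite D" "card D \<le> 4"
  proof -
    have *: "finite (g (j - 1))" "card (g (j - 1)) = 2" "finite (g (j - 2))" "card (g (j - 2)) = 2"
      using card2 jk by auto
    then show "finite D" by (simp add: D_def)
    have "card D \<le> card (g (j - 1) \<union> g (j - 2))"
      using * unfolding D_def by (intro card_mono) auto
    also have "\<dots> \<le> 4" using card_Un_le[of "g (j - 1)" "g (j - 2)"] * by linarith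
    finally show "card D \<le> 4" .
  qed
  define B where "B i = A i - D" for i
  have B: "B i \<subseteq> verts H" "card (verts F) + 2 \<le> card (B i)" if "i < r" for i
    using A'[OF that] diff_card_le_card_Diff[OF D(1), of "A i"] D(2) by (auto simp: B_def)
  have xB: "x \<in> B a" and yB: "y \<in> B b" using xy by (auto simp: B_def D_def)
  have early: "\<exists>l. {p, q} = g l \<and> l + 3 \<le> j \<and> l < k"
    if pq: "i < r" "i' < r" "i \<noteq> i'" "p \<in> B i" "q \<in> B i'" "{p, q} \<noteq> {x, y}" for i i' p q
  proof -
    obtain l where l: "l \<in> X" "{p, q} = g l" using X[of i i' p q] pq by (auto simp: B_def)
    have lk: "l < k" using l by (auto simp: X_def)
    have "l \<noteq> j" using l pq xy by auto
    have "p \<noteq> q" using pair[OF lk] l by (auto simp: doubleton_eq_iff)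
    have "\<not> {p, q} \<subseteq> g (j - 1) \<union> g (j - 2)"
    proof
      assume "{p, q} \<subseteq> g (j - 1) \<union> g (j - 2)"
      then have "{p, q} \<subseteq> {x, y}" using pq by (auto simp: B_def D_def)
      then show False using \<open>p \<noteq> q\<close> pq(6) by auto
    qed
    then have "l \<noteq> j - 1" "l \<noteq> j - 2" using l by auto
    then show ?thesis using jmax[OF l(1)] \<open>l \<noteq> j\<close> l lk by (intro exI[of _ l]) auto
  qed
  \<comment> \<open>One further cross pair, \<open>{p, y}\<close>, already forces
    \<open>3 \<le> j\<close>, so that \<open>j - 2\<close> is a genuine difference.\<close>
  have "\<exists>p\<in>B a. p \<noteq> x"
  proof (rule ccontr)
    assume "\<not> ?thesis"
    then have "B a \<subseteq> {x}" by auto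
    then have "card (B a) \<le> 1" using card_mono[of "{x}" "B a"] by simp
    then show False using B(2)[OF xy(1)] by simp
  qed
  then obtain p where "p \<in> B a" "p \<noteq> x" by auto
  then have "3 \<le> j" using early[of a b p y] xy yB \<open>x \<noteq> y\<close> by (auto simp: doubleton_eq_iff)
  define K where "K = process F H (j - 2)"
  have "{x, y} \<in> edges (process_step F (process_step F K))"
  proof (rule two_steps_complete_multipartite[OF _ F c, of K B])
    show "is_graph K" by (simp add: K_def is_graph_process H)
    show "B i \<subseteq> verts K \<and> card (verts F) + 1 \<le> card (B i)" if "i < r" for i
      using B[OF that] by (simp add: K_def)
    fix i i' p q
    assume "i < r" "i' < r" "i \<noteq> i'" "p \<in> B i" "q \<in> B i'" "{p, q} \<noteq> {x, y}"
    from early[OF this] obtain l where l: "{p, q} = g l" "l + 3 \<le> j" "l < k" by blast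
    have "g l \<in> edges (process F H (Suc l))" using g[OF l(3)] by blast
    also have "\<dots> \<subseteq> edges K" unfolding K_def using l by (intro edges_process_mono) simp
    finally show "{p, q} \<in> edges K" by (simp add: l)
  qed (use xy xB yB \<open>x \<noteq> y\<close> in auto)
  moreover have "process_step F (process_step F K) = process F H (Suc (Suc (j - 2)))"
    by (simp add: K_def)
  moreover have "Suc (Suc (j - 2)) = j" using \<open>3 \<le> j\<close> by simp
  ultimately show False using g[OF jk] xy(6) by auto
qed

section \<open>One new edge per step, and the running time\<close>

text \<open>Minimality in \<open>running_time\<close> means that no earlier stage equals its
  successor, whether or not a stable stage is known to exist. As the vertex set is constant, the
  edge set must grow.\<close>

lemma new_edge_sequence:
  obtains g where "\<And>i. i < running_time F H \<Longrightarrow> g i \<in> edges (process F H (Suc i)) - edges (process F H i)"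
proof -
  have "\<exists>f. f \<in> edges (process F H (Suc i)) - edges (process F H i)" if "i < running_time F H" for i
  proof (rule ccontr)
    assume "\<not> ?thesis"
    then have "edges (process F H (Suc i)) = edges (process F H i)"
      using edges_process_mono[of i "Suc i" F H] by auto
    then have "process F H i = process F H (Suc i)" by simp
    with not_less_Least[OF that[unfolded running_time_def]] show False by blast
  qed
  then show ?thesis using that by metis
qed

lemma new_edge_sequence_inj:
  assumes "\<And>i. i < k \<Longrightarrow> g i \<in> edges (process F H (Suc i)) - edges (process F H i)"
  shows "inj_on g {..<k}"
proof (rule linorder_inj_onI')
  fix i j assume "i \<in> {..<k}" "j \<in> {..<k}" "i < j"
  then have "g i \<in> edges (process F H j)" "g j \<notin> edges (process F H j)"
    using assms edges_process_mono[of "Suc i" j F H] by (auto dest!: subsetD)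
  then show "g i \<noteq> g j" by auto
qed

lemma new_edges_subset:
  assumes "is_graph H" "\<And>i. i < k \<Longrightarrow> g i \<in> edges (process F H (Suc i)) - edges (process F H i)"
  shows "g ` {..<k} \<subseteq> [verts H]\<^bsup>2\<^esup>"
proof -
  have "edges (process F H (Suc i)) \<subseteq> [verts H]\<^bsup>2\<^esup>" for i
    using is_graphD(3)[OF is_graph_process[OF assms(1)], of F "Suc i"] by (simp only: verts_process)
  then show ?thesis using assms(2) by blast
qed

lemma running_time_le:
  assumes "is_graph H"
  shows "running_time F H \<le> card (verts H) choose 2"
proof -
  obtain g where g: "\<And>i. i < running_time F H \<Longrightarrow> g i \<in> edges (process F H (Suc i)) - edges (process F H i)"
    using new_edge_sequence by blast
  have "running_time F H = card (g ` {..<running_time F H})"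
    using new_edge_sequence_inj[OF g] by (simp add: card_image)
  also have "\<dots> \<le> card ([verts H]\<^bsup>2\<^esup>)"
    using new_edges_subset[OF assms g] is_graphD(1)[OF assms]
    by (intro card_mono) (auto intro: finite_imp_finite_nsets)
  finally show ?thesis using is_graphD(1)[OF assms] by (simp add: card_nsets)
qed

text \<open>The set of running times is finite by \<open>running_time_le\<close> and nonempty
  because of the edgeless graph, so \<open>Max\<close> belongs to it.\<close>

lemma max_running_time_attained:
  obtains H :: "nat ugraph" where "is_graph H" "card (verts H) = n" "max_running_time F n = running_time F H"
proof -
  let ?R = "{running_time F H | H :: nat ugraph. is_graph H \<and> card (verts H) = n}"
  have "?R \<subseteq> {..n choose 2}" using running_time_le by auto
  then have "finite ?R" by (rule finite_subset) simp
  moreover have "running_time F \<lparr>verts = {..<n}, edges = {}\<rparr> \<in> ?R"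
    by (intro CollectI exI[of _ "\<lparr>verts = {..<n}, edges = {}\<rparr>"]) (simp add: is_graph_def)
  ultimately have "Max ?R \<in> ?R" by (intro Max_in) auto
  then show ?thesis using that unfolding max_running_time_def by blast
qed

section \<open>The chromatic number and the final bound\<close>

text \<open>An injective numbering of the vertices is a proper colouring, so the
  \<open>LEAST\<close> in the definition is attained.\<close>

lemma chromatic_number_colouring:
  assumes "is_graph G"
  obtains c where "proper_colouring G (chromatic_number G) c"
proof -
  obtain f n where "f ` verts G = {i::nat. i < n}" "inj_on f (verts G)"
    using finite_imp_inj_to_nat_seg[OF is_graphD(1)[OF assms]] by blast
  then have "proper_colouring G n f"
    unfolding proper_colouring_def
  proof (intro conjI allI impI)
    fix u v assume "{u, v} \<in> edges G"
    from is_graph_edgeD[OF assms this] inj_on_eq_iff[OF \<open>inj_on f (verts G)\<close>]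
    show "f u \<noteq> f v" by blast
  qed auto
  then have "\<exists>c. proper_colouring G (chromatic_number G) c"
    unfolding chromatic_number_def by (intro LeastI[of "\<lambda>k. \<exists>c. proper_colouring G k c" n] exI)
  with that show ?thesis by blast
qed

lemma proper_colouring_mono:
  "proper_colouring G k c \<Longrightarrow> k \<le> k' \<Longrightarrow> proper_colouring G k' c"
  by (auto simp: proper_colouring_def)

theorem theorem1p2:
  fixes F :: "'a ugraph" and e :: "'a set"
  assumes "is_graph F" and "e \<in> edges F"
  shows "\<forall>\<epsilon>::real. \<epsilon> > 0 \<longrightarrow> (\<exists>n\<^sub>0::nat. \<forall>n\<ge>n\<^sub>0.
           real (max_running_time F n) \<le>
             ((real (chromatic_number (del_edge F e)) - 2) / (real (chromatic_number (del_edge F e)) - 1) + \<epsilon>)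
               * real (n choose 2))"
proof (intro allI impI)
  fix \<epsilon> :: real assume "0 < \<epsilon>"
  define \<chi> where "\<chi> = chromatic_number (del_edge F e)"
  \<comment> \<open>\<open>Suc s\<close> is the number of parts, \<open>max 2 \<chi>\<close>.
    Erdos--Stone needs \<open>0 < s\<close>, and a colouring with \<chi> colours is also one with
    \<open>Suc s\<close> colours.\<close>
  define s where "s = max 1 (\<chi> - 1)"
  obtain u v where e: "e = {u, v}" using is_graph_edgeE[OF assms] .
  obtain c where "proper_colouring (del_edge F e) \<chi> c"
    using chromatic_number_colouring[OF is_graph_del_edge[OF assms(1)]] unfolding \<chi>_def .
  then have c: "proper_colouring (del_edge F {u, v}) (Suc s) c"
    unfolding e by (rule proper_colouring_mono) (simp add: s_def)
  have bound: "1 - 1 / real s \<le> (real \<chi> - 2) / (real \<chi> - 1)"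
  proof (cases "\<chi> \<le> 1")
    case True
    then have "\<chi> = 0 \<or> \<chi> = 1" by linarith
    (* for chi = 1 the right-hand side is -1 / 0 = 0 *)
    then show ?thesis by (auto simp: s_def)
  next
    case False
    then have "s = \<chi> - 1" by (simp add: s_def)
    then show ?thesis using False by (simp add: of_nat_diff field_simps)
  qed
  have "0 < s" by (simp add: s_def)
  obtain n\<^sub>0 where n0: "\<And>(V :: nat set) E. finite V \<Longrightarrow> n\<^sub>0 \<le> card V \<Longrightarrow> E \<subseteq> [V]\<^bsup>2\<^esup> \<Longrightarrow>
    (1 - 1 / real s + \<epsilon>) * (card V choose 2) \<le> card E \<Longrightarrow> (\<exists>A. multipartite V E (Suc s) (card (verts F) + 6) A)"
    using erdos_stone[OF \<open>0 < \<epsilon>\<close> \<open>0 < s\<close>, where t = "card (verts F) + 6" and 'a = nat] by blast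
  show "\<exists>n\<^sub>0. \<forall>n\<ge>n\<^sub>0. real (max_running_time F n) \<le>
      ((real (chromatic_number (del_edge F e)) - 2) / (real (chromatic_number (del_edge F e)) - 1) + \<epsilon>) * real (n choose 2)"
  proof (intro exI[of _ n\<^sub>0] allI impI)
    fix n assume "n\<^sub>0 \<le> n"
    obtain H :: "nat ugraph" where H: "is_graph H" "card (verts H) = n" "max_running_time F n = running_time F H"
      using max_running_time_attained .
    obtain g where g: "\<And>i. i < running_time F H \<Longrightarrow> g i \<in> edges (process F H (Suc i)) - edges (process F H i)"
      using new_edge_sequence by blast
    let ?E = "g ` {..<running_time F H}"
    \<comment> \<open>Without such a multipartite graph the chosen edges are too few for
      Erdos--Stone; being distinct, they number exactly the running time.\<close>
    have "\<not> multipartite (verts H) ?E (Suc s) (card (verts F) + 6) A" for A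
      using not_multipartite_new_edges[OF H(1) assms(1) assms(2)[unfolded e] c g] \<open>0 < s\<close> by simp
    then have "\<not> (1 - 1 / real s + \<epsilon>) * (card (verts H) choose 2) \<le> card ?E"
      using n0[OF is_graphD(1)[OF H(1)] _ new_edges_subset[OF H(1) g]] \<open>n\<^sub>0 \<le> n\<close> H(2) by blast
    moreover have "card ?E = running_time F H"
      using new_edge_sequence_inj[OF g] by (simp add: card_image)
    ultimately have "real (max_running_time F n) \<le> (1 - 1 / real s + \<epsilon>) * (n choose 2)"
      using H by simp
    also have "\<dots> \<le> ((real \<chi> - 2) / (real \<chi> - 1) + \<epsilon>) * (n choose 2)"
      using bound by (intro mult_right_mono) auto
    finally show "real (max_running_time F n) \<le>
      ((real (chromatic_number (del_edge F e)) - 2) / (real (chromatic_number (del_edge F e)) - 1) + \<epsilon>) * real (n choose 2)"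
      unfolding \<chi>_def .
  qed
qed

end
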